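(* Let $G$ be an infinite transitive graph with a distinguished vertex $v$, and let $M$ be a transition kernel on $V(G)$ which is invariant under a subgroup $H$ of the automorphism group of $G$ acting transitively on $V(G)$, i.e. $M(h(x),h(y))=M(x,y)$ for all $x,y\in V(G)$ and $h\in H$. Let $\Psi$ be the law of the Markov chain with transition kernel $M$ and initial state $v$, viewed as a probability measure on the space $\Gamma(G,v)$ of infinite paths in $G$ from $v$, and assume that this chain is transient. Let $\mu\neq\nu$ be probability measures on a finite set $\Omega$ with $\mu(\omega)>0$ and $\nu(\omega)>0$ for all $\omega\in\Omega$. Then the associated measures $P$ and $Q$ on $\Omega^{V(G)}$ are either mutually singular or mutually absolutely continuous.
   Context: The vertex set $V(G)$ is countable. $\Gamma(G,v)$ denotes the space of infinite paths $v,v_1,v_2,\ldots$ in $G$ (consecutive vertices adjacent, vertices may be repeated) starting at $v$, with the topology induced from the product topology; thus the chain takes its steps along edges of $G$. For $\mathcal X\in\Gamma(G,v)$, $[\mathcal X]\subseteq V(G)$ is the set of vertices visited by $\mathcal X$. Define $P=\mu^{V(G)}$ (the product measure on $\Omega^{V(G)}$), let $Q_{\mathcal X}=\mu^{V(G)\setminus[\mathcal X]}\times\nu^{[\mathcal X]}$ be the product measure on $\Omega^{V(G)}$ under which the labels are independent, with law $\nu$ on $[\mathcal X]$ and law $\mu$ off $[\mathcal X]$, and define $Q(A)=\int_{\Gamma(G,v)}Q_{\mathcal X}(A)\,d\Psi(\mathcal X)$ for Borel $A\subseteq\Omega^{V(G)}$. *)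

theory Defs
  imports "HOL-Probability.Probability" "HOL-Algebra.Bij"
begin

(* An undirected graph without multiple edges. Loops are not excluded, so both conventions
   are covered. *)
definition graph :: "'v set \<Rightarrow> ('v \<times> 'v) set \<Rightarrow> bool" where
  "graph V E \<longleftrightarrow> E \<subseteq> V \<times> V \<and> sym E"

definition graph_aut :: "'v set \<Rightarrow> ('v \<times> 'v) set \<Rightarrow> ('v \<Rightarrow> 'v) set" where
  "graph_aut V E = {f \<in> Bij V. \<forall>x\<in>V. \<forall>y\<in>V. (f x, f y) \<in> E \<longleftrightarrow> (x, y) \<in> E}"

definition graph_aut_group :: "'v set \<Rightarrow> ('v \<times> 'v) set \<Rightarrow> ('v \<Rightarrow> 'v) monoid" where
  "graph_aut_group V E = BijGroup V \<lparr>carrier := graph_aut V E\<rparr>"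

definition acts_transitively_on :: "('v \<Rightarrow> 'v) set \<Rightarrow> 'v set \<Rightarrow> bool" where
  "acts_transitively_on H V \<longleftrightarrow> (\<forall>x\<in>V. \<forall>y\<in>V. \<exists>h\<in>H. h x = y)"

definition transitive_graph :: "'v set \<Rightarrow> ('v \<times> 'v) set \<Rightarrow> bool" where
  "transitive_graph V E \<longleftrightarrow> graph V E \<and> acts_transitively_on (graph_aut V E) V"

definition infinite_paths :: "('v \<times> 'v) set \<Rightarrow> 'v \<Rightarrow> (nat \<Rightarrow> 'v) set" where
  "infinite_paths E v = {X. X 0 = v \<and> (\<forall>n. (X n, X (Suc n)) \<in> E)}"

(* V is countable and discrete, so the product sigma-algebra on the sequences in V is the Borel
   sigma-algebra of the product topology. The measure of PiM plays no role here: this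
   measure only carries the underlying set and the sigma-algebra. *)
definition path_space :: "'v set \<Rightarrow> ('v \<times> 'v) set \<Rightarrow> 'v \<Rightarrow> (nat \<Rightarrow> 'v) measure" where
  "path_space V E v =
     restrict_space (PiM UNIV (\<lambda>_::nat. count_space V)) (infinite_paths E v)"

definition transition_kernel_on :: "'v set \<Rightarrow> ('v \<Rightarrow> 'v pmf) \<Rightarrow> bool" where
  "transition_kernel_on V M \<longleftrightarrow> (\<forall>x\<in>V. set_pmf (M x) \<subseteq> V)"

(* The cylinder probabilities determine Psi. Since Psi lives on the paths of the graph, the
   chain is forced to take its steps along edges: a step x i, x (Suc i) that is not an edge
   makes the cylinder empty. *)
definition markov_chain_law ::
    "'v set \<Rightarrow> ('v \<times> 'v) set \<Rightarrow> ('v \<Rightarrow> 'v pmf) \<Rightarrow> 'v \<Rightarrow> (nat \<Rightarrow> 'v) measure \<Rightarrow> bool" where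
  "markov_chain_law V E M v \<Psi> \<longleftrightarrow>
     prob_space \<Psi> \<and> sets \<Psi> = sets (path_space V E v) \<and>
     (\<forall>n. \<forall>x \<in> UNIV \<rightarrow> V. x 0 = v \<longrightarrow>
        measure \<Psi> {X \<in> space \<Psi>. \<forall>i\<le>n. X i = x i} = (\<Prod>i<n. pmf (M (x i)) (x (Suc i))))"

definition transient_law :: "'v set \<Rightarrow> (nat \<Rightarrow> 'v) measure \<Rightarrow> bool" where
  "transient_law V \<Psi> \<longleftrightarrow> (\<forall>x\<in>V. AE X in \<Psi>. finite {n. X n = x})"

(* The sigma-algebra is the Borel one when V is countable and the label type is finite. *)
definition label_space :: "'v set \<Rightarrow> ('v \<Rightarrow> 'o) measure" where
  "label_space V = PiM V (\<lambda>_. count_space UNIV)"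

definition P_measure :: "'v set \<Rightarrow> 'o pmf \<Rightarrow> ('v \<Rightarrow> 'o) measure" where
  "P_measure V \<mu> = PiM V (\<lambda>_. measure_pmf \<mu>)"

definition Q_path :: "'v set \<Rightarrow> 'o pmf \<Rightarrow> 'o pmf \<Rightarrow> (nat \<Rightarrow> 'v) \<Rightarrow> ('v \<Rightarrow> 'o) measure" where
  "Q_path V \<mu> \<nu> X = PiM V (\<lambda>x. measure_pmf (if x \<in> range X then \<nu> else \<mu>))"

(* measure_of yields the zero measure if the given set function is not countably additive;
   lemma emeasure_Q_measure below shows that this does not happen. *)
definition Q_measure ::
    "'v set \<Rightarrow> 'o pmf \<Rightarrow> 'o pmf \<Rightarrow> (nat \<Rightarrow> 'v) measure \<Rightarrow> ('v \<Rightarrow> 'o) measure" where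
  "Q_measure V \<mu> \<nu> \<Psi> =
     measure_of (space (label_space V)) (sets (label_space V))
       (\<lambda>A. \<integral>\<^sup>+ X. emeasure (Q_path V \<mu> \<nu> X) A \<partial>\<Psi>)"

definition mutually_singular :: "'a measure \<Rightarrow> 'a measure \<Rightarrow> bool" where
  "mutually_singular M N \<longleftrightarrow>
     (\<exists>A \<in> sets M \<inter> sets N. emeasure M A = 0 \<and> emeasure N (space N - A) = 0)"

definition mutually_absolutely_continuous :: "'a measure \<Rightarrow> 'a measure \<Rightarrow> bool" where
  "mutually_absolutely_continuous M N \<longleftrightarrow>
     absolutely_continuous M N \<and> absolutely_continuous N M"

lemma sets_P_measure: "sets (P_measure V \<mu>) = sets (label_space V)"
  unfolding P_measure_def label_space_def by (intro sets_PiM_cong) auto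

lemma sets_Q_path: "sets (Q_path V \<mu> \<nu> X) = sets (label_space V)"
  unfolding Q_path_def label_space_def by (intro sets_PiM_cong) auto

lemma sets_Q_measure: "sets (Q_measure V \<mu> \<nu> \<Psi>) = sets (label_space V)"
  unfolding Q_measure_def by simp

lemma prob_space_Q_path: "prob_space (Q_path V \<mu> \<nu> X)"
  unfolding Q_path_def by (intro prob_space_PiM) (rule prob_space_measure_pmf)

lemma measurable_Q_path:
  assumes \<Psi>: "sets \<Psi> = sets (path_space V E v)"
  shows "Q_path V \<mu> \<nu> \<in> measurable \<Psi> (prob_algebra (label_space V))"
proof (rule measurable_prob_algebra_generated)
  show "sets (label_space V :: ('a \<Rightarrow> 'b) measure) =
      sigma_sets (\<Pi>\<^sub>E i\<in>V. space (count_space UNIV)) (prod_algebra V (\<lambda>_. count_space UNIV))"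
    unfolding label_space_def by (rule sets_PiM)
  show "Int_stable (prod_algebra V (\<lambda>_. count_space (UNIV :: 'b set)))"
    by (rule Int_stable_prod_algebra)
  show "prod_algebra V (\<lambda>_. count_space (UNIV :: 'b set)) \<subseteq>
      Pow (\<Pi>\<^sub>E i\<in>V. space (count_space UNIV))"
    by (rule prod_algebra_sets_into_space)
  show "prob_space (Q_path V \<mu> \<nu> X)" for X by (rule prob_space_Q_path)
  show "sets (Q_path V \<mu> \<nu> X) = sets (label_space V)" for X by (rule sets_Q_path)
next
  fix A :: "('a \<Rightarrow> 'b) set"
  assume "A \<in> prod_algebra V (\<lambda>_. count_space UNIV)"
  then obtain J F where J: "finite J" "J \<subseteq> V"
    and A: "A = prod_emb V (\<lambda>_. count_space UNIV) J (\<Pi>\<^sub>E j\<in>J. F j)"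
    by (auto elim!: prod_algebraE)
  have eq: "emeasure (Q_path V \<mu> \<nu> X) A =
      (\<Prod>j\<in>J. if \<exists>n. X n = j then emeasure (measure_pmf \<nu>) (F j)
             else emeasure (measure_pmf \<mu>) (F j))" for X
  proof -
    let ?M = "\<lambda>x. measure_pmf (if x \<in> range X then \<nu> else \<mu>)"
    interpret product_prob_space ?M V
      by (intro product_prob_spaceI prob_space_measure_pmf)
    have "A = prod_emb V ?M J (\<Pi>\<^sub>E j\<in>J. F j)"
      unfolding A prod_emb_def by simp
    then have "emeasure (Q_path V \<mu> \<nu> X) A = (\<Prod>j\<in>J. emeasure (?M j) (F j))"
      unfolding Q_path_def using emeasure_PiM_emb[OF J(2,1), of F] by simp
    also have "\<dots> = (\<Prod>j\<in>J. if \<exists>n. X n = j then emeasure (measure_pmf \<nu>) (F j)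
             else emeasure (measure_pmf \<mu>) (F j))"
      by (intro prod.cong) (auto simp: image_iff)
    finally show ?thesis .
  qed
  have visit: "(\<lambda>X. \<exists>n. X n = j) \<in> measurable \<Psi> (count_space UNIV)" for j
  proof -
    have 1: "(\<lambda>X. X n) \<in> measurable \<Psi> (count_space V)" for n
      unfolding measurable_cong_sets[OF \<Psi> refl] path_space_def
      by (intro measurable_restrict_space1) measurable
    have "(\<lambda>X. X n = j) \<in> measurable \<Psi> (count_space UNIV)" for n
      using measurable_compose[OF 1, of "\<lambda>x. x = j" "count_space UNIV" n] by simp
    then show ?thesis by measurable
  qed
  show "(\<lambda>X. emeasure (Q_path V \<mu> \<nu> X) A) \<in> borel_measurable \<Psi>"
    unfolding eq
    by (intro borel_measurable_prod_ennreal measurable_If borel_measurable_const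
        visit[unfolded pred_def])
qed

lemma emeasure_Q_measure:
  assumes \<Psi>: "sets \<Psi> = sets (path_space V E v)" and A: "A \<in> sets (label_space V)"
  shows "emeasure (Q_measure V \<mu> \<nu> \<Psi>) A = (\<integral>\<^sup>+ X. emeasure (Q_path V \<mu> \<nu> X) A \<partial>\<Psi>)"
proof (rule emeasure_measure_of[OF Q_measure_def])
  have meas: "(\<lambda>X. emeasure (Q_path V \<mu> \<nu> X) B) \<in> borel_measurable \<Psi>"
    if "B \<in> sets (label_space V)" for B
    using measurable_prob_algebraD[OF measurable_Q_path[OF \<Psi>]] that
    by (rule measurable_emeasure_kernel)
  show "countably_additive (sets (Q_measure V \<mu> \<nu> \<Psi>))
      (\<lambda>A. \<integral>\<^sup>+ X. emeasure (Q_path V \<mu> \<nu> X) A \<partial>\<Psi>)"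
  proof (rule countably_additiveI)
    fix B :: "nat \<Rightarrow> ('a \<Rightarrow> 'b) set"
    assume B: "range B \<subseteq> sets (Q_measure V \<mu> \<nu> \<Psi>)" "disjoint_family B"
    then have B': "B i \<in> sets (label_space V)" for i by (auto simp: sets_Q_measure)
    have "(\<Sum>i. \<integral>\<^sup>+ X. emeasure (Q_path V \<mu> \<nu> X) (B i) \<partial>\<Psi>) =
        (\<integral>\<^sup>+ X. (\<Sum>i. emeasure (Q_path V \<mu> \<nu> X) (B i)) \<partial>\<Psi>)"
      by (intro nn_integral_suminf[symmetric] meas B')
    also have "\<dots> = (\<integral>\<^sup>+ X. emeasure (Q_path V \<mu> \<nu> X) (\<Union>i. B i) \<partial>\<Psi>)"
      using B B' by (intro nn_integral_cong suminf_emeasure) (auto simp: sets_Q_path)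
    finally show "(\<Sum>i. \<integral>\<^sup>+ X. emeasure (Q_path V \<mu> \<nu> X) (B i) \<partial>\<Psi>) =
        (\<integral>\<^sup>+ X. emeasure (Q_path V \<mu> \<nu> X) (\<Union>i. B i) \<partial>\<Psi>)" .
  qed
qed (use A sets.space_closed in \<open>auto simp: sets_Q_measure positive_def\<close>)

end

theory Submission
  imports Defs
begin

text \<open>Write \<open>Q\<^sub>X\<close> for the law of the labels when the trail is the range of the path \<open>X\<close>. Two zero-one laws carry
the proof.

The first is Kolmogorov's: under a product measure, a set of labellings that is closed under
changing finitely many labels has measure 0 or 1 (\<open>finite_change_closed_zero_one\<close>). Since all
labels have positive probability under both laws, changing a single label preserves null sets, so
any null set can be enlarged to a null set that is closed under finite changes
(\<open>null_finite_change_closure\<close>). This applies to \<open>P\<close>, to every \<open>Q\<^sub>X\<close>, and hence to null sets of the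
mixture \<open>Q\<close>. One half of the dichotomy follows: if \<open>B\<close> is \<open>Q\<close>-null but not \<open>P\<close>-null, its closure is
still \<open>Q\<close>-null and has \<open>P\<close>-measure 1, so \<open>P\<close> and \<open>Q\<close> are singular.

For the other half, let \<open>A\<close> be a \<open>P\<close>-null set for which \<open>Q(A)\<close> is maximal. If \<open>Q(A) = 0\<close> then \<open>Q\<close> is
absolutely continuous with respect to \<open>P\<close>, and if \<open>Q(A) = 1\<close> the two are singular; the task is to
exclude the values in between. Enlarging \<open>A\<close> by countably many of its translates and then by finite
changes, one may assume that it is closed under finite changes and maximal in the same sense for the
chains from all other vertices. Then \<open>Q\<^sub>X(A)\<close> is 0 or 1 for every \<open>X\<close>, and \<open>Q(A)\<close> is the probability of the event \<open>D\<close> that \<open>Q\<^sub>X(A) = 1\<close>. Dropping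
the first vertex of \<open>X\<close> changes the trail in at most one vertex, so \<open>D\<close> is invariant under the shift.
A shift-invariant event of a Markov chain need not be trivial, and here the symmetry enters: a
symmetry \<open>h\<close> with \<open>h v = x\<close> maps the chain from \<open>v\<close> to the chain from \<open>x\<close> and preserves \<open>P\<close>. By
maximality of \<open>A\<close>, the chain has the same probability of being in \<open>D\<close> from every starting vertex \<open>x\<close>.
By the Markov property \<open>D\<close> is then independent of the path up to any finite time, hence independent
of itself (\<open>symmetric_shift_invariant_zero_one\<close>).\<close>

section \<open>Independent labels\<close>

definition label_measure :: "'v set \<Rightarrow> ('v \<Rightarrow> 'o pmf) \<Rightarrow> ('v \<Rightarrow> 'o) measure" where
  "label_measure V N = PiM V (\<lambda>x. measure_pmf (N x))"

lemma P_measure_eq: "P_measure V \<mu> = label_measure V (\<lambda>_. \<mu>)"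
  by (simp add: P_measure_def label_measure_def)

lemma Q_path_eq: "Q_path V \<mu> \<nu> X = label_measure V (\<lambda>x. if x \<in> range X then \<nu> else \<mu>)"
  by (simp add: Q_path_def label_measure_def)

lemma sets_label_measure [measurable_cong]: "sets (label_measure V N) = sets (label_space V)"
  unfolding label_measure_def label_space_def by (intro sets_PiM_cong) auto

lemma space_label_measure: "space (label_measure V N) = space (label_space V)"
  by (rule sets_eq_imp_space_eq[OF sets_label_measure])

lemma space_label_space: "space (label_space V :: ('v \<Rightarrow> 'o) measure) = (\<Pi>\<^sub>E x\<in>V. (UNIV :: 'o set))"
  by (simp add: label_space_def space_PiM)

lemma prob_space_label_measure: "prob_space (label_measure V N)"
  unfolding label_measure_def by (intro prob_space_PiM prob_space_measure_pmf)

lemma measurable_label_update: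
  assumes "j \<in> V"
  shows "(\<lambda>w. w(j := a)) \<in> measurable (label_space V) (label_space V)"
  unfolding label_space_def using assms
  by (intro measurable_fun_upd[where J="V"]) (auto simp: insert_absorb)

lemma measurable_label_coordinate:
  assumes "j \<in> V"
  shows "(\<lambda>w. w j) \<in> measurable (label_space V) (count_space UNIV)"
  unfolding label_space_def using assms by (rule measurable_component_singleton)

text \<open>A product measure is the product of its factor at \<open>j\<close> with the product over the other coordinates,
and membership in \<open>A\<close> depends on the latter only. The right-hand side therefore involves the law at
\<open>j\<close> only through \<open>F\<close>. The label \<open>undefined\<close> stands for an arbitrary one.\<close>

lemma emeasure_label_measure_split:
  fixes N :: "'v \<Rightarrow> 'o pmf"
  assumes j: "j \<in> V" and A: "A \<in> sets (label_space V)"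
    and inv: "\<And>w a. w \<in> A \<Longrightarrow> w(j := a) \<in> A"
  shows "emeasure (label_measure V N) {w \<in> A. w j \<in> F} =
    emeasure (measure_pmf (N j)) F *
    emeasure (label_measure (V - {j}) N)
      {w \<in> space (label_space (V - {j})). w(j := undefined) \<in> A}"
proof -
  let ?R = "label_measure (V - {j}) N"
  let ?u = "\<lambda>(x, w). w(j := x)"
  let ?B = "{w \<in> space (label_space (V - {j})). w(j := undefined) \<in> A}"
  interpret R: prob_space ?R by (rule prob_space_label_measure)
  have V: "insert j (V - {j}) = V" using j by auto
  have eq: "distr (measure_pmf (N j) \<Otimes>\<^sub>M ?R) (label_measure V N) ?u = label_measure V N"
    using distr_pair_PiM_eq_PiM[of "V - {j}" "\<lambda>x. measure_pmf (N x)" j] prob_space_measure_pmf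
    unfolding label_measure_def V by blast
  have u: "?u \<in> measurable (measure_pmf (N j) \<Otimes>\<^sub>M ?R) (label_measure V N)"
    unfolding label_measure_def case_prod_beta
    by (intro measurable_fun_upd[where J="V - {j}"]) (use V in auto)
  have Y: "?B \<in> sets ?R"
  proof -
    have "(\<lambda>w. w(j := undefined)) \<in> measurable ?R (label_measure V N)"
      unfolding label_measure_def
      by (intro measurable_fun_upd[where J="V - {j}"]) (use V in auto)
    from measurable_sets[OF this, of A] show ?thesis
      using A by (simp add: sets_label_measure space_label_measure vimage_def Int_def conj_commute)
  qed
  have iff: "w(j := x) \<in> A \<longleftrightarrow> w(j := undefined) \<in> A" for w x
    using inv[of "w(j := x)" undefined] inv[of "w(j := undefined)" x] by auto
  have C: "{w \<in> A. w j \<in> F} \<in> sets (label_measure V N)"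
  proof -
    have "{w \<in> A. w j \<in> F} = A \<inter> ((\<lambda>w. w j) -` F \<inter> space (label_space V))"
      using sets.sets_into_space[OF A] by auto
    then show ?thesis
      using A measurable_sets[OF measurable_label_coordinate[OF j], of F]
      by (simp add: sets_label_measure)
  qed
  have "emeasure (label_measure V N) {w \<in> A. w j \<in> F} =
      emeasure (measure_pmf (N j) \<Otimes>\<^sub>M ?R)
        (?u -` {w \<in> A. w j \<in> F} \<inter> space (measure_pmf (N j) \<Otimes>\<^sub>M ?R))"
    by (subst eq[symmetric], rule emeasure_distr[OF u C])
  also have "?u -` {w \<in> A. w j \<in> F} \<inter> space (measure_pmf (N j) \<Otimes>\<^sub>M ?R) = F \<times> ?B"
  proof (intro Set.set_eqI)
    fix p :: "'o \<times> ('v \<Rightarrow> 'o)"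
    obtain x w where p: "p = (x, w)" by (cases p)
    show "p \<in> ?u -` {w \<in> A. w j \<in> F} \<inter> space (measure_pmf (N j) \<Otimes>\<^sub>M ?R) \<longleftrightarrow>
        p \<in> F \<times> ?B"
      using iff[of w x] by (auto simp: p space_pair_measure space_label_measure)
  qed
  also have "emeasure (measure_pmf (N j) \<Otimes>\<^sub>M ?R) (F \<times> ?B) = emeasure (measure_pmf (N j)) F * emeasure ?R ?B"
    by (rule R.emeasure_pair_measure_Times) (use Y in auto)
  finally show ?thesis .
qed

lemma emeasure_label_measure_indep_coordinate:
  fixes N :: "'v \<Rightarrow> 'o pmf"
  assumes "j \<in> V" "A \<in> sets (label_space V)" "\<And>w a. w \<in> A \<Longrightarrow> w(j := a) \<in> A"
  shows "emeasure (label_measure V N) {w \<in> A. w j \<in> F} =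
    emeasure (measure_pmf (N j)) F * emeasure (label_measure V N) A"
  using emeasure_label_measure_split[OF assms, of N F]
    emeasure_label_measure_split[OF assms, of N UNIV]
  using measure_pmf.emeasure_space_1[of "N j"] by simp

text \<open>This is what makes \<open>Q\<^sub>X(A)\<close> unaffected by a change of the trail in one vertex: by the preceding
splitting, the measure of \<open>A\<close> is determined by the laws at the other vertices.\<close>

lemma emeasure_label_measure_cong_off:
  fixes N N' :: "'v \<Rightarrow> 'o pmf"
  assumes "A \<in> sets (label_space V)" "\<And>w a. w \<in> A \<Longrightarrow> w(j := a) \<in> A"
    and N': "\<And>x. x \<in> V \<Longrightarrow> x \<noteq> j \<Longrightarrow> N x = N' x"
  shows "emeasure (label_measure V N) A = emeasure (label_measure V N') A"
proof (cases "j \<in> V")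
  case True
  have "label_measure (V - {j}) N = label_measure (V - {j}) N'"
    unfolding label_measure_def by (intro PiM_cong) (auto simp: N')
  then show ?thesis
    using emeasure_label_measure_split[OF True assms(1,2), of N UNIV]
      emeasure_label_measure_split[OF True assms(1,2), of N' UNIV]
      measure_pmf.emeasure_space_1[of "N j"] measure_pmf.emeasure_space_1[of "N' j"] by simp
next
  case False
  then have "N x = N' x" if "x \<in> V" for x using N' that by blast
  then have "label_measure V N = label_measure V N'"
    unfolding label_measure_def by (intro PiM_cong) auto
  then show ?thesis by simp
qed

text \<open>The preimage \<open>B\<close> of \<open>A\<close> under setting the label at \<open>j\<close> to \<open>a\<close> is insensitive to the label at \<open>j\<close>, and
those elements of \<open>B\<close> that already carry \<open>a\<close> at \<open>j\<close> belong to \<open>A\<close>. By independence these make up the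
positive proportion \<open>pmf (N j) a\<close> of \<open>B\<close>.\<close>

lemma null_label_update:
  fixes N :: "'v \<Rightarrow> 'o pmf"
  assumes j: "j \<in> V" and A: "A \<in> null_sets (label_measure V N)" and a: "pmf (N j) a > 0"
  shows "(\<lambda>w. w(j := a)) -` A \<inter> space (label_space V) \<in> null_sets (label_measure V N)"
proof -
  let ?B = "(\<lambda>w. w(j := a)) -` A \<inter> space (label_space V)"
  have As: "A \<in> sets (label_space V)" using A by (auto simp: sets_label_measure)
  have B: "?B \<in> sets (label_space V)"
    by (rule measurable_sets[OF measurable_label_update[OF j] As])
  have inv: "w(j := b) \<in> ?B" if "w \<in> ?B" for w b
    using that j by (auto simp: space_label_space)
  have "emeasure (measure_pmf (N j)) {a} * emeasure (label_measure V N) ?B =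
      emeasure (label_measure V N) {w \<in> ?B. w j \<in> {a}}"
    by (rule emeasure_label_measure_indep_coordinate[OF j B inv, symmetric])
  also have "\<dots> \<le> emeasure (label_measure V N) A"
    by (rule emeasure_mono) (use As in \<open>auto simp: sets_label_measure\<close>)
  also have "\<dots> = 0" using A by auto
  finally have "emeasure (label_measure V N) ?B = 0"
    using a by (auto simp: emeasure_pmf_single)
  then show ?thesis using B by (auto simp: null_sets_def sets_label_measure)
qed

section \<open>Finite changes of the labels and Kolmogorov's zero-one law\<close>

definition finite_change_closed :: "'v set \<Rightarrow> ('v \<Rightarrow> 'o) set \<Rightarrow> bool" where
  "finite_change_closed V A \<longleftrightarrow> (\<forall>w\<in>A. \<forall>j\<in>V. \<forall>a. w(j := a) \<in> A)"

definition update_labels :: "('v \<times> 'o) list \<Rightarrow> ('v \<Rightarrow> 'o) \<Rightarrow> 'v \<Rightarrow> 'o" where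
  "update_labels l = foldr (\<lambda>(j, a) w. w(j := a)) l"

text \<open>Finite changes are given as lists of single updates: over a countable vertex set there are only
countably many of them, and inverting one update amounts to appending another.\<close>

definition finite_change_closure :: "'v set \<Rightarrow> ('v \<Rightarrow> 'o) set \<Rightarrow> ('v \<Rightarrow> 'o) set" where
  "finite_change_closure V A =
     (\<Union>l\<in>lists (V \<times> UNIV). update_labels l -` A \<inter> space (label_space V))"

lemma finite_change_closed_closure: "finite_change_closed V (finite_change_closure V A)"
  unfolding finite_change_closed_def
proof (intro ballI allI)
  fix w j a assume w: "w \<in> finite_change_closure V A" and j: "j \<in> V"
  then obtain l where l: "l \<in> lists (V \<times> UNIV)" "update_labels l w \<in> A"
    and sp: "w \<in> space (label_space V)"
    by (auto simp: finite_change_closure_def)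
  \<comment> \<open>The update appended at the end is executed first and restores the label at \<open>j\<close>.\<close>
  have "update_labels (l @ [(j, w j)]) (w(j := a)) = update_labels l w"
    by (simp add: update_labels_def)
  moreover have "l @ [(j, w j)] \<in> lists (V \<times> UNIV)" using l j by auto
  moreover have "w(j := a) \<in> space (label_space V)" using sp j by (auto simp: space_label_space)
  ultimately show "w(j := a) \<in> finite_change_closure V A"
    using l(2) unfolding finite_change_closure_def by fastforce
qed

lemma finite_change_closure_superset:
  assumes "A \<subseteq> space (label_space V)"
  shows "A \<subseteq> finite_change_closure V A"
  using assms by (force simp: finite_change_closure_def update_labels_def intro!: bexI[of _ "[]"])

text \<open>The closure is a countable union of preimages of \<open>A\<close> under finite sequences of single updates, and each
single update preserves null sets.\<close>

lemma null_finite_change_closure: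
  fixes N :: "'v \<Rightarrow> 'o::finite pmf"
  assumes V: "countable V" and A: "A \<in> null_sets (label_measure V N)"
    and N: "\<And>x a. pmf (N x) a > 0"
  shows "finite_change_closure V A \<in> null_sets (label_measure V N)"
  unfolding finite_change_closure_def
proof (rule null_sets_UN')
  have "countable (V \<times> (UNIV :: 'o set))" using V by (intro countable_SIGMA) (auto intro: countable_finite)
  then show "countable (lists (V \<times> (UNIV :: 'o set)))" by (rule countable_lists)
next
  fix l :: "('v \<times> 'o) list" assume "l \<in> lists (V \<times> UNIV)"
  then show "update_labels l -` A \<inter> space (label_space V) \<in> null_sets (label_measure V N)"
    using A
  proof (induction l arbitrary: A)
    case Nil
    then show ?case
      using sets.sets_into_space[of A "label_space V"]
      by (simp add: update_labels_def sets_label_measure Int_absorb2 null_sets_def)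
  next
    case (Cons p l)
    obtain j a where p: "p = (j, a)" "j \<in> V" using Cons.hyps by (cases p) auto
    let ?B = "(\<lambda>w. w(j := a)) -` A \<inter> space (label_space V)"
    have upd: "update_labels l w \<in> space (label_space V)" if "w \<in> space (label_space V)" for w
      using Cons.hyps(2) that
      by (induction l) (auto simp: update_labels_def space_label_space PiE_def extensional_def)
    have "?B \<in> null_sets (label_measure V N)"
      by (rule null_label_update) (use p Cons.prems N in auto)
    then have "update_labels l -` ?B \<inter> space (label_space V) \<in> null_sets (label_measure V N)"
      by (rule Cons.IH)
    also have "update_labels l -` ?B \<inter> space (label_space V) =
        update_labels (p # l) -` A \<inter> space (label_space V)"
      using upd by (auto simp: update_labels_def p)
    finally show ?case .
  qed
qed

lemma sets_finite_change_closure: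
  fixes A :: "('v \<Rightarrow> 'o::finite) set"
  assumes V: "countable V" and A: "A \<in> sets (label_space V)"
  shows "finite_change_closure V A \<in> sets (label_space V)"
  unfolding finite_change_closure_def
proof (rule sets.countable_UN'')
  have "countable (V \<times> (UNIV :: 'o set))" using V by (intro countable_SIGMA) (auto intro: countable_finite)
  then show "countable (lists (V \<times> (UNIV :: 'o set)))" by (rule countable_lists)
next
  fix l :: "('v \<times> 'o) list" assume l: "l \<in> lists (V \<times> UNIV)"
  have "update_labels l \<in> measurable (label_space V) (label_space V)"
    using l
  proof (induction l)
    case Nil
    then show ?case by (simp add: update_labels_def id_def)
  next
    case (Cons p l)
    obtain j a where p: "p = (j, a)" "j \<in> V" using Cons.hyps by (cases p) auto
    have "update_labels (p # l) = (\<lambda>w. (update_labels l w)(j := a))"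
      by (simp add: update_labels_def p fun_eq_iff)
    then show ?case
      using measurable_compose[OF Cons.IH measurable_label_update[OF p(2)]] by metis
  qed
  then show "update_labels l -` A \<inter> space (label_space V) \<in> sets (label_space V)"
    using A by (rule measurable_sets)
qed

text \<open>The hypothesis says that \<open>A\<close> is independent of all events. In this form it can be checked on a
generator by uniqueness of measures.\<close>

lemma (in prob_space) zero_one_of_self_independent:
  assumes A: "A \<in> events" and eq: "density M (indicator A) = scale_measure (emeasure M A) M"
  shows "emeasure M A = 0 \<or> emeasure M A = 1"
proof -
  have "emeasure (density M (indicator A)) A = emeasure (scale_measure (emeasure M A) M) A"
    by (simp add: eq)
  then have "emeasure M A = emeasure M A * emeasure M A"
    using A by (simp add: emeasure_restricted)
  then have "prob A = prob A * prob A"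
    by (simp add: emeasure_eq_measure ennreal_mult[symmetric])
  then have "prob A = 0 \<or> prob A = 1"
    using mult_cancel_right1[of "prob A" "prob A"] by blast
  then show ?thesis by (auto simp: emeasure_eq_measure)
qed

text \<open>Adding the coordinates one at a time shows that \<open>A\<close> is independent of every finite set of coordinates,
because the part of \<open>A\<close> cut out by conditions on the labels in \<open>J\<close> is still insensitive to a label outside \<open>J\<close>. Boxes
over finitely many coordinates generate the \<open>\<sigma>\<close>-algebra, so \<open>A\<close> is independent of itself.\<close>

lemma finite_change_closed_zero_one:
  fixes N :: "'v \<Rightarrow> 'o pmf"
  assumes A: "A \<in> sets (label_space V)" and closed: "finite_change_closed V A"
  shows "emeasure (label_measure V N) A = 0 \<or> emeasure (label_measure V N) A = 1"
proof -
  let ?N = "label_measure V N"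
  interpret N: prob_space ?N by (rule prob_space_label_measure)
  have cyl: "emeasure ?N {w \<in> A. \<forall>j\<in>J. w j \<in> F j} =
      (\<Prod>j\<in>J. emeasure (measure_pmf (N j)) (F j)) * emeasure ?N A"
    if "finite J" "J \<subseteq> V" for J and F :: "'v \<Rightarrow> 'o set"
    using that
  proof (induction J)
    case empty
    then show ?case by simp
  next
    case (insert k J)
    let ?B = "{w \<in> A. \<forall>j\<in>J. w j \<in> F j}"
    have "?B = A \<inter> {w \<in> space (label_space V). \<forall>j\<in>J. w j \<in> F j}"
      using sets.sets_into_space[OF A] by auto
    also have "\<dots> \<in> sets (label_space V)"
    proof (intro sets.Int A sets.sets_Collect_finite_All)
      fix j assume "j \<in> J"
      then have "j \<in> V" using insert.prems by auto
      from measurable_sets[OF measurable_label_coordinate[OF this], of "F j"]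
      show "{w \<in> space (label_space V). w j \<in> F j} \<in> sets (label_space V)"
        by (simp add: vimage_def Int_def conj_commute)
    qed (use insert in auto)
    finally have B: "?B \<in> sets (label_space V)" .
    have k: "k \<in> V" using insert.prems by auto
    have inv: "w(k := a) \<in> ?B" if "w \<in> ?B" for w a
      using that closed k insert.hyps(2) by (auto simp: finite_change_closed_def)
    have "{w \<in> A. \<forall>j\<in>insert k J. w j \<in> F j} = {w \<in> ?B. w k \<in> F k}" by auto
    then show ?case
      using emeasure_label_measure_indep_coordinate[OF k B inv, of N "F k"] insert
      by (simp add: mult.assoc)
  qed
  let ?c = "emeasure ?N A"
  have As: "A \<in> sets ?N" using A by (simp add: sets_label_measure)
  have "density ?N (indicator A) = scale_measure ?c ?N"
    unfolding label_measure_def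
  proof (rule measure_eqI_PiM_infinite[where M="\<lambda>x. measure_pmf (N x)" and I=V])
    fix J F assume J: "finite J" "J \<subseteq> V"
    interpret product_prob_space "\<lambda>x. measure_pmf (N x)" V
      by (intro product_prob_spaceI prob_space_measure_pmf)
    let ?E = "prod_emb V (\<lambda>x. measure_pmf (N x)) J (Pi\<^sub>E J F)"
    have E: "?E \<in> sets ?N"
      unfolding label_measure_def using J by (intro sets_PiM_I) auto
    have "A \<inter> ?E = {w \<in> A. \<forall>j\<in>J. w j \<in> F j}"
      using sets.sets_into_space[OF A] J by (auto simp: prod_emb_def space_label_space PiE_iff)
    then have "emeasure (density ?N (indicator A)) ?E = emeasure ?N {w \<in> A. \<forall>j\<in>J. w j \<in> F j}"
      using As E by (simp add: emeasure_restricted)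
    also have "\<dots> = emeasure (scale_measure ?c ?N) ?E"
      using cyl[OF J, of F] emeasure_PiM_emb[OF J(2,1), of F]
      by (simp add: label_measure_def mult.commute)
    finally show "emeasure (density (PiM V (\<lambda>x. measure_pmf (N x))) (indicator A)) ?E =
        emeasure (scale_measure (emeasure (PiM V (\<lambda>x. measure_pmf (N x))) A)
          (PiM V (\<lambda>x. measure_pmf (N x)))) ?E"
      unfolding label_measure_def .
  next
    have "finite_measure (density ?N (indicator A))"
      by (intro finite_measureI) (use As in \<open>simp add: emeasure_restricted\<close>)
    then show "finite_measure (density (PiM V (\<lambda>x. measure_pmf (N x))) (indicator A))"
      unfolding label_measure_def .
  qed (simp_all)
  then show ?thesis by (rule N.zero_one_of_self_independent[OF As])
qed

section \<open>Paths and the Markov property\<close>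

abbreviation seq_space :: "'v set \<Rightarrow> (nat \<Rightarrow> 'v) measure" where
  "seq_space V \<equiv> PiM UNIV (\<lambda>_. count_space V)"

lemma space_seq_space: "X \<in> space (seq_space V) \<longleftrightarrow> (\<forall>n. X n \<in> V)"
  by (auto simp: space_PiM)

definition cylinder :: "'v set \<Rightarrow> 'v list \<Rightarrow> (nat \<Rightarrow> 'v) set" where
  "cylinder V l = {X \<in> space (seq_space V). \<forall>i<length l. X i = l ! i}"

lemma sets_cylinder: "cylinder V l \<in> sets (seq_space V)"
proof -
  have "{X \<in> space (seq_space V). \<forall>i\<in>{..<length l}. X i = l ! i} \<in> sets (seq_space V)"
  proof (intro sets.sets_Collect_finite_All)
    fix i
    have "(\<lambda>X. X i) -` ({l ! i} \<inter> V) \<inter> space (seq_space V) \<in> sets (seq_space V)"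
      by (rule measurable_sets[OF measurable_component_singleton]) auto
    also have "(\<lambda>X. X i) -` ({l ! i} \<inter> V) \<inter> space (seq_space V) = {X \<in> space (seq_space V). X i = l ! i}"
      by (auto simp: space_seq_space)
    finally show "{X \<in> space (seq_space V). X i = l ! i} \<in> sets (seq_space V)" .
  qed auto
  then show ?thesis by (simp add: cylinder_def)
qed

text \<open>For countable \<open>V\<close> a condition on the \<open>i\<close>-th vertex is a countable union of cylinders, one for each
possible initial segment of length \<open>i + 1\<close>.\<close>

lemma sets_seq_space_cylinders:
  assumes "countable V"
  shows "sets (seq_space V) = sigma_sets (space (seq_space V)) (insert {} (cylinder V ` lists V))"
    (is "_ = sigma_sets ?\<Omega> ?G")
proof (intro equalityI)
  show "sigma_sets ?\<Omega> ?G \<subseteq> sets (seq_space V)"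
    by (intro sets.sigma_sets_subset) (auto intro: sets_cylinder)
  have "f \<in> sigma_sets ?\<Omega> ?G"
    if f: "f \<in> {{f \<in> \<Pi>\<^sub>E i\<in>UNIV. space (count_space V). f i \<in> A} |i A. i \<in> UNIV \<and> A \<in> sets (count_space V)}" for f
  proof -
    obtain i :: nat and A where A: "A \<subseteq> V" and f: "f = {X. (\<forall>n. X n \<in> V) \<and> X i \<in> A}"
      using f by auto
    let ?L = "{l \<in> lists V. length l = Suc i \<and> l ! i \<in> A}"
    have "f = (\<Union>l\<in>?L. cylinder V l)"
    proof (intro Set.set_eqI iffI)
      fix X assume X: "X \<in> f"
      have "map X [0..<Suc i] \<in> ?L" "X \<in> cylinder V (map X [0..<Suc i])"
        using X by (auto simp: f cylinder_def space_seq_space simp del: upt_Suc)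
      then show "X \<in> (\<Union>l\<in>?L. cylinder V l)" by blast
    qed (auto simp: f cylinder_def space_seq_space)
    also have "\<dots> \<in> sigma_sets ?\<Omega> ?G"
    proof (rule sigma_sets_UNION)
      have "countable ?L" using countable_lists[OF assms] by (rule countable_subset[rotated]) auto
      then show "countable (cylinder V ` ?L)" by simp
    qed auto
    finally show ?thesis .
  qed
  then show "sets (seq_space V) \<subseteq> sigma_sets ?\<Omega> ?G"
    unfolding sets_PiM_single space_PiM by (intro sigma_sets_mono) blast
qed

lemma cylinder_Int_cases:
  assumes "length l \<le> length l'"
  shows "cylinder V l \<inter> cylinder V l' = cylinder V l' \<or> cylinder V l \<inter> cylinder V l' = {}"
proof (cases "\<forall>i<length l. l ! i = l' ! i")
  case True
  then show ?thesis using assms by (auto simp: cylinder_def)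
next
  case False
  then have "cylinder V l \<inter> cylinder V l' = {}" using assms by (fastforce simp: cylinder_def)
  then show ?thesis by simp
qed

lemma measure_eqI_cylinders:
  assumes V: "countable V"
    and M: "sets M = sets (seq_space V)" and N: "sets N = sets (seq_space V)"
    and fin: "finite_measure M"
    and eq: "\<And>l. l \<in> lists V \<Longrightarrow> emeasure M (cylinder V l) = emeasure N (cylinder V l)"
  shows "M = N"
proof (rule measure_eqI_generator_eq)
  let ?G = "insert {} (cylinder V ` lists V)"
  show "Int_stable ?G"
  proof (rule Int_stableI)
    have *: "cylinder V l \<inter> cylinder V l' \<in> ?G"
      if "l \<in> lists V" "l' \<in> lists V" for l l'
    proof (cases "length l \<le> length l'")
      case True
      then show ?thesis using cylinder_Int_cases[of l l' V] that by auto
    next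
      case False
      then show ?thesis using cylinder_Int_cases[of l' l V] that by (auto simp: Int_commute)
    qed
    fix a b assume "a \<in> ?G" "b \<in> ?G"
    then show "a \<inter> b \<in> ?G" using * by blast
  qed
  show "?G \<subseteq> Pow (space (seq_space V))" by (auto simp: cylinder_def)
  show "sets M = sigma_sets (space (seq_space V)) ?G" "sets N = sigma_sets (space (seq_space V)) ?G"
    using M N sets_seq_space_cylinders[OF V] by simp_all
  show "range (\<lambda>_::nat. cylinder V []) \<subseteq> ?G" by auto
  show "(\<Union>i::nat. cylinder V []) = space (seq_space V)" by (auto simp: cylinder_def)
  show "emeasure M (cylinder V []) \<noteq> \<infinity>" for i :: nat
    using finite_measure.emeasure_finite[OF fin] by simp
qed (use eq in auto)

fun path_prob :: "('v \<Rightarrow> 'v pmf) \<Rightarrow> 'v list \<Rightarrow> real" where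
  "path_prob M (x # y # l) = pmf (M x) y * path_prob M (y # l)"
| "path_prob M _ = 1"

lemma path_prob_eq_prod:
  "path_prob M l = (\<Prod>i<length l - 1. pmf (M (l ! i)) (l ! Suc i))"
proof (induction l rule: induct_list012)
  case (3 x y l)
  then show ?case by (simp add: prod.lessThan_Suc_shift del: prod.lessThan_Suc)
qed simp_all

lemma path_prob_nonneg: "0 \<le> path_prob M l"
  by (induction M l rule: path_prob.induct) simp_all

lemma path_prob_append:
  "w \<noteq> [] \<Longrightarrow> path_prob M (w @ l) = path_prob M w * path_prob M (last w # l)"
proof (induction M w rule: path_prob.induct)
  case (1 M x y w)
  then show ?case by (simp del: last.simps add: last_ConsR)
qed auto

lemma path_prob_map:
  assumes "\<And>x y. x \<in> V \<Longrightarrow> y \<in> V \<Longrightarrow> pmf (M (h x)) (h y) = pmf (M x) y" "l \<in> lists V"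
  shows "path_prob M (map h l) = path_prob M l"
  using assms(2)
proof (induction l rule: induct_list012)
  case (3 x y l)
  then have "path_prob M (map h (y # l)) = path_prob M (y # l)" "x \<in> V" "y \<in> V" by auto
  then show ?case using assms(1)[of x y] by simp
qed simp_all

text \<open>The law of the chain started at \<open>v\<close>, carried by all sequences in \<open>V\<close> rather than by the paths
from \<open>v\<close>, so that shifted paths and paths moved by a symmetry live in the same space. The empty
word is excluded because its cylinder is the whole space and \<open>hd []\<close> is unspecified.\<close>

definition path_law :: "'v set \<Rightarrow> ('v \<Rightarrow> 'v pmf) \<Rightarrow> 'v \<Rightarrow> (nat \<Rightarrow> 'v) measure \<Rightarrow> bool" where
  "path_law V M v R \<longleftrightarrow> prob_space R \<and> sets R = sets (seq_space V) \<and>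
     (\<forall>l\<in>lists V. l \<noteq> [] \<longrightarrow>
        emeasure R (cylinder V l) = (if hd l = v then ennreal (path_prob M l) else 0))"

definition kernel_symmetry :: "'v set \<Rightarrow> ('v \<Rightarrow> 'v pmf) \<Rightarrow> ('v \<Rightarrow> 'v) \<Rightarrow> bool" where
  "kernel_symmetry V M h \<longleftrightarrow>
     bij_betw h V V \<and> (\<forall>x\<in>V. \<forall>y\<in>V. pmf (M (h x)) (h y) = pmf (M x) y)"

lemma measurable_seq_space:
  assumes "\<And>i. (\<lambda>X. f X i) \<in> measurable R (count_space V)"
  shows "f \<in> measurable R (seq_space V)"
proof (rule measurable_PiM_single')
  show "f \<in> space R \<rightarrow> UNIV \<rightarrow>\<^sub>E space (count_space V)"
    using measurable_space[OF assms] by (auto simp: PiE_UNIV_domain)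
qed (rule assms)

lemma measurable_shift: "(\<lambda>X i. X (i + n)) \<in> measurable (seq_space V) (seq_space V)"
  by (rule measurable_seq_space) (rule measurable_component_singleton, simp)

lemma measurable_map_path:
  assumes "h \<in> V \<rightarrow> V"
  shows "(\<lambda>X i. h (X i)) \<in> measurable (seq_space V) (seq_space V)"
proof (rule measurable_seq_space)
  have h: "h \<in> measurable (count_space V) (count_space V)" using assms by simp
  show "(\<lambda>X. h (X i)) \<in> measurable (seq_space V) (count_space V)" for i
    by (rule measurable_compose[OF measurable_component_singleton[of i UNIV "\<lambda>_. count_space V"] h]) simp
qed

lemma cylinder_shift:
  assumes "w \<noteq> []" "l \<noteq> []"
  shows "{X \<in> cylinder V w. (\<lambda>i. X (i + (length w - 1))) \<in> cylinder V l} =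
    (if hd l = last w then cylinder V (w @ tl l) else {})"
proof -
  define n where "n = length w - 1"
  have n: "length w = Suc n" "last w = w ! n" "hd l = l ! 0"
    using assms by (auto simp: n_def last_conv_nth hd_conv_nth)
  have "(X \<in> cylinder V w \<and> (\<lambda>i. X (i + n)) \<in> cylinder V l) \<longleftrightarrow>
      hd l = last w \<and> X \<in> cylinder V (w @ tl l)" for X
  proof safe
    assume X: "X \<in> cylinder V w" "(\<lambda>i. X (i + n)) \<in> cylinder V l"
    then have l: "X (i + n) = l ! i" if "i < length l" for i
      using that by (auto simp: cylinder_def)
    have w: "X i = w ! i" if "i < Suc n" for i
      using that X by (auto simp: cylinder_def n)
    show "hd l = last w" using l[of 0] w[of n] assms n by simp
    have "X i = (w @ tl l) ! i" if i: "i < length (w @ tl l)" for i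
    proof (cases "i < Suc n")
      case True
      then show ?thesis using w by (simp add: nth_append n)
    next
      case False
      then have "i - n < length l" "i - n + n = i" "i - n = Suc (i - Suc n)" using i n by auto
      then show ?thesis using l[of "i - n"] False i by (simp add: nth_append n nth_tl)
    qed
    then show "X \<in> cylinder V (w @ tl l)" using X by (simp add: cylinder_def)
  next
    assume h: "hd l = last w" and X: "X \<in> cylinder V (w @ tl l)"
    then have wl: "X i = (w @ tl l) ! i" if "i < length (w @ tl l)" for i
      using that by (auto simp: cylinder_def)
    show "X \<in> cylinder V w"
      using X wl by (auto simp: cylinder_def nth_append)
    have "X (i + n) = l ! i" if i: "i < length l" for i
    proof (cases i)
      case 0
      then show ?thesis using wl[of n] h n by (simp add: nth_append)
    next
      case (Suc k)
      then show ?thesis using wl[of "i + n"] i n by (simp add: nth_append nth_tl)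
    qed
    then show "(\<lambda>i. X (i + n)) \<in> cylinder V l"
      using X by (auto simp: cylinder_def space_seq_space)
  qed
  then have "{X \<in> cylinder V w. (\<lambda>i. X (i + n)) \<in> cylinder V l} =
      {X. hd l = last w \<and> X \<in> cylinder V (w @ tl l)}"
    by (intro Collect_cong)
  then show ?thesis unfolding n_def by (cases "hd l = last w") simp_all
qed

text \<open>Given that the path begins with \<open>w\<close>, its continuation is a chain started at \<open>last w\<close>, which has the
same law as the image under \<open>h\<close> of the chain started at \<open>v\<close>. In this form
a single law \<open>R\<close> describes the continuation from every vertex. Both sides are finite measures in \<open>S\<close>, and they agree on
cylinders: the word \<open>w\<close> continued by \<open>l\<close> has the product of the two path probabilities, and \<open>h\<close>
leaves path probabilities unchanged. The continuation starts with the last letter of \<open>w\<close>, hence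
the shift by \<open>length w - 1\<close>.\<close>

lemma markov_property:
  assumes V: "countable V" and R: "path_law V M v R"
    and w: "w \<in> lists V" "w \<noteq> []" "hd w = v"
    and h: "kernel_symmetry V M h" "h v = last w" and v: "v \<in> V"
    and S: "S \<in> sets (seq_space V)"
  shows "emeasure R {X \<in> cylinder V w. (\<lambda>i. X (i + (length w - 1))) \<in> S} =
    emeasure R (cylinder V w) * emeasure R {X \<in> space (seq_space V). (\<lambda>i. h (X i)) \<in> S}"
proof -
  interpret R: prob_space R using R by (simp add: path_law_def)
  have Rs [measurable_cong]: "sets R = sets (seq_space V)" using R by (simp add: path_law_def)
  have Rsp: "space R = space (seq_space V)" using Rs by (rule sets_eq_imp_space_eq)
  have Rc: "emeasure R (cylinder V l) = (if hd l = v then ennreal (path_prob M l) else 0)"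
    if "l \<in> lists V" "l \<noteq> []" for l
    using R that by (simp add: path_law_def)
  have bij: "bij_betw h V V" and hM: "\<And>x y. x \<in> V \<Longrightarrow> y \<in> V \<Longrightarrow> pmf (M (h x)) (h y) = pmf (M x) y"
    using h by (auto simp: kernel_symmetry_def)
  have hV: "h \<in> V \<rightarrow> V" using bij by (auto simp: bij_betw_def)
  let ?sh = "\<lambda>X i. X (i + (length w - 1))" and ?h = "\<lambda>X i. h (X i)"
  let ?W = "cylinder V w" and ?D = "density R (indicator (cylinder V w))"
  have sh: "?sh \<in> measurable R (seq_space V)"
    using measurable_shift unfolding measurable_cong_sets[OF Rs refl] .
  have hm: "?h \<in> measurable R (seq_space V)"
    using measurable_map_path[OF hV] unfolding measurable_cong_sets[OF Rs refl] .
  have W: "?W \<in> sets R" by (simp add: Rs sets_cylinder)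
  have M1: "emeasure (distr ?D (seq_space V) ?sh) T = emeasure R {X \<in> ?W. ?sh X \<in> T}"
    if T: "T \<in> sets (seq_space V)" for T
  proof -
    have T': "?sh -` T \<inter> space R \<in> sets R" using sh T by (rule measurable_sets)
    have "emeasure (distr ?D (seq_space V) ?sh) T = emeasure ?D (?sh -` T \<inter> space R)"
      using emeasure_distr[of ?sh ?D "seq_space V" T] sh T by simp
    also have "\<dots> = emeasure R (?W \<inter> (?sh -` T \<inter> space R))"
      using W T' by (simp add: emeasure_restricted)
    also have "?W \<inter> (?sh -` T \<inter> space R) = {X \<in> ?W. ?sh X \<in> T}"
      using sets.sets_into_space[OF W] by auto
    finally show ?thesis .
  qed
  have M2: "emeasure (scale_measure (emeasure R ?W) (distr R (seq_space V) ?h)) T =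
      emeasure R ?W * emeasure R {X \<in> space (seq_space V). ?h X \<in> T}"
    if T: "T \<in> sets (seq_space V)" for T
  proof -
    have "?h -` T \<inter> space R = {X \<in> space (seq_space V). ?h X \<in> T}" by (auto simp: Rsp)
    then show ?thesis using emeasure_distr[OF hm T] by simp
  qed
  have eq: "distr ?D (seq_space V) ?sh = scale_measure (emeasure R ?W) (distr R (seq_space V) ?h)"
  proof (rule measure_eqI_cylinders[OF V])
    have "emeasure (distr ?D (seq_space V) ?sh) (space (seq_space V)) \<noteq> \<infinity>"
      by (subst M1) auto
    then show "finite_measure (distr ?D (seq_space V) ?sh)"
      by (intro finite_measureI) simp
  next
    fix l assume l: "l \<in> lists V"
    have "emeasure R {X \<in> ?W. ?sh X \<in> cylinder V l} =
        emeasure R ?W * emeasure R {X \<in> space (seq_space V). ?h X \<in> cylinder V l}"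
    proof (cases "l = []")
      case True
      have "?sh X \<in> space (seq_space V)" if "X \<in> space (seq_space V)" for X
        using that by (simp add: space_seq_space)
      then have "{X \<in> ?W. ?sh X \<in> cylinder V l} = ?W"
        by (auto simp: True cylinder_def)
      moreover have "?h X \<in> space (seq_space V)" if "X \<in> space (seq_space V)" for X
        using that hV by (auto simp: space_seq_space)
      then have "{X \<in> space (seq_space V). ?h X \<in> cylinder V l} = space R"
        by (auto simp: True cylinder_def Rsp)
      ultimately show ?thesis by (simp add: R.emeasure_space_1)
    next
      case False
      let ?g = "inv_into V h"
      have g: "?g x \<in> V" "h (?g x) = x" if "x \<in> V" for x
        using bij that by (auto simp: bij_betw_def inv_into_into f_inv_into_f)
      have gh: "?g (h x) = x" if "x \<in> V" for x
        using bij that by (simp add: bij_betw_inv_into_left)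
      have lV: "l ! i \<in> V" if "i < length l" for i using l that by (auto simp: in_lists_conv_set)
      have "{X \<in> space (seq_space V). ?h X \<in> cylinder V l} = cylinder V (map ?g l)"
      proof (intro Set.set_eqI)
        fix X
        have "h (X i) = l ! i \<longleftrightarrow> X i = ?g (l ! i)" if "X \<in> space (seq_space V)" "i < length l" for i
          using that g[OF lV, of i] gh[of "X i"] by (auto simp: space_seq_space)
        moreover have "?h X \<in> space (seq_space V)" if "X \<in> space (seq_space V)"
          using that hV by (auto simp: space_seq_space)
        ultimately show "X \<in> {X \<in> space (seq_space V). ?h X \<in> cylinder V l} \<longleftrightarrow> X \<in> cylinder V (map ?g l)"
          by (auto simp: cylinder_def)
      qed
      moreover have gl: "map ?g l \<in> lists V" using l g by auto
      moreover have "path_prob M (map ?g l) = path_prob M l"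
      proof -
        have "map h (map ?g l) = l" using l g by (auto simp: map_idI)
        then show ?thesis using path_prob_map[of V M h, OF hM gl] by simp
      qed
      moreover have "hd (map ?g l) = v \<longleftrightarrow> hd l = last w"
      proof -
        have "hd l \<in> V" using l False by (cases l) auto
        then have "?g (hd l) = v \<longleftrightarrow> hd l = last w" using gh[OF v] g(2) h(2) by metis
        then show ?thesis using False by (simp add: hd_map)
      qed
      ultimately have rhs: "emeasure R {X \<in> space (seq_space V). ?h X \<in> cylinder V l} =
          (if hd l = last w then ennreal (path_prob M l) else 0)"
        using Rc[of "map ?g l"] False by simp
      have lhs: "emeasure R {X \<in> ?W. ?sh X \<in> cylinder V l} =
          (if hd l = last w then ennreal (path_prob M w * path_prob M l) else 0)"
      proof (cases "hd l = last w")
        case True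
        have "w @ tl l \<in> lists V" using w l by (cases l) auto
        then have "emeasure R (cylinder V (w @ tl l)) = ennreal (path_prob M (w @ tl l))"
          using Rc[of "w @ tl l"] w(2,3) by simp
        also have "path_prob M (w @ tl l) = path_prob M w * path_prob M l"
          using path_prob_append[OF w(2), of M "tl l"] True False by (metis list.collapse)
        finally show ?thesis using cylinder_shift[OF w(2) False] True by simp
      next
        case False': False
        then show ?thesis unfolding cylinder_shift[OF w(2) False] by simp
      qed
      show ?thesis
        unfolding lhs rhs Rc[OF w(1,2)] w(3) by (simp add: ennreal_mult path_prob_nonneg)
    qed
    then show "emeasure (distr ?D (seq_space V) ?sh) (cylinder V l) =
        emeasure (scale_measure (emeasure R ?W) (distr R (seq_space V) ?h)) (cylinder V l)"
      by (simp only: M1 M2 sets_cylinder)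
  qed simp_all
  show ?thesis by (rule M1[OF S, unfolded eq, unfolded M2[OF S], symmetric])
qed

text \<open>Given any initial segment, the conditional probability of \<open>D\<close> is by shift invariance and the Markov
property the probability that the chain from the current vertex is in \<open>D\<close>. By hypothesis this does not
depend on the vertex, so \<open>D\<close> is independent of every initial segment, and therefore of itself.\<close>

lemma symmetric_shift_invariant_zero_one:
  assumes V: "countable V" and R: "path_law V M v R" and v: "v \<in> V"
    and D: "D \<in> sets (seq_space V)"
    and shift: "\<And>X. X \<in> space (seq_space V) \<Longrightarrow> (\<lambda>i. X (Suc i)) \<in> D \<longleftrightarrow> X \<in> D"
    and sym: "\<And>x. x \<in> V \<Longrightarrow> \<exists>h. kernel_symmetry V M h \<and> h v = x \<and>
      emeasure R {X \<in> space (seq_space V). (\<lambda>i. h (X i)) \<in> D} = emeasure R D"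
  shows "emeasure R D = 0 \<or> emeasure R D = 1"
proof -
  interpret R: prob_space R using R by (simp add: path_law_def)
  have Rs: "sets R = sets (seq_space V)" using R by (simp add: path_law_def)
  have DR: "D \<in> sets R" using D Rs by simp
  have shift_n: "(\<lambda>i. X (i + n)) \<in> D \<longleftrightarrow> X \<in> D" if "X \<in> space (seq_space V)" for X n
  proof (induction n)
    case (Suc n)
    have "(\<lambda>i. X (i + n)) \<in> space (seq_space V)" using that by (simp add: space_seq_space)
    from shift[OF this] show ?case using Suc by simp
  qed simp
  have ind: "emeasure R (D \<inter> cylinder V w) = emeasure R D * emeasure R (cylinder V w)"
    if w: "w \<in> lists V" for w
  proof (cases "w = [] \<or> hd w \<noteq> v")
    case True
    then consider "w = []" | "w \<noteq> []" "hd w \<noteq> v" by blast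
    then show ?thesis
    proof cases
      case 1
      then have "cylinder V w = space R"
        using sets_eq_imp_space_eq[OF Rs] by (simp add: cylinder_def)
      then show ?thesis
        using sets.sets_into_space[OF DR] by (simp add: R.emeasure_space_1 Int_absorb2)
    next
      case 2
      then have 0: "emeasure R (cylinder V w) = 0"
        using R w by (simp add: path_law_def)
      have "emeasure R (D \<inter> cylinder V w) \<le> emeasure R (cylinder V w)"
        by (rule emeasure_mono) (auto simp: Rs sets_cylinder)
      then show ?thesis using 0 by simp
    qed
  next
    case False
    then have "last w \<in> V" using w by (auto simp: in_lists_conv_set)
    then obtain h where h: "kernel_symmetry V M h" "h v = last w"
      "emeasure R {X \<in> space (seq_space V). (\<lambda>i. h (X i)) \<in> D} = emeasure R D"
      using sym by blast
    have "D \<inter> cylinder V w = {X \<in> cylinder V w. (\<lambda>i. X (i + (length w - 1))) \<in> D}"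
      using shift_n by (auto simp: cylinder_def)
    then show ?thesis
      using markov_property[OF V R w _ _ h(1,2) v D] False h(3) by (simp add: mult.commute)
  qed
  have "density R (indicator D) = scale_measure (emeasure R D) R"
  proof (rule measure_eqI_cylinders[OF V])
    show "finite_measure (density R (indicator D))"
      by (intro finite_measureI) (use DR in \<open>simp add: emeasure_restricted\<close>)
    show "emeasure (density R (indicator D)) (cylinder V l) =
        emeasure (scale_measure (emeasure R D) R) (cylinder V l)" if "l \<in> lists V" for l
      using ind[OF that] DR sets_cylinder[of V l]
      by (simp add: Rs emeasure_restricted)
  qed (simp_all add: Rs)
  then show ?thesis by (rule R.zero_one_of_self_independent[OF DR])
qed

section \<open>Trails under symmetries and shifts\<close>

definition relabel :: "'v set \<Rightarrow> ('v \<Rightarrow> 'v) \<Rightarrow> ('v \<Rightarrow> 'o) \<Rightarrow> 'v \<Rightarrow> 'o" where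
  "relabel V g w = (\<lambda>x\<in>V. w (g x))"

lemma measurable_relabel:
  assumes "g \<in> V \<rightarrow> V"
  shows "relabel V g \<in> measurable (label_space V) (label_space V)"
  unfolding label_space_def relabel_def
proof (rule measurable_restrict)
  fix x assume "x \<in> V"
  then show "(\<lambda>w. w (g x)) \<in> measurable (PiM V (\<lambda>_. count_space UNIV)) (count_space UNIV)"
    using assms by (intro measurable_component_singleton) auto
qed

lemma emeasure_label_measure_relabel:
  fixes N N' :: "'v \<Rightarrow> 'o pmf"
  assumes g: "bij_betw g V V" and A: "A \<in> sets (label_space V)"
    and N': "\<And>x. x \<in> V \<Longrightarrow> N' x = N (g x)"
  shows "emeasure (label_measure V N) (relabel V g -` A \<inter> space (label_space V)) =
    emeasure (label_measure V N') A"
proof -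
  have g': "inj_on g V" "g \<in> V \<rightarrow> V" using g by (auto simp: bij_betw_def)
  have "label_measure V N' = PiM V (\<lambda>x. measure_pmf (N (g x)))"
    unfolding label_measure_def by (intro PiM_cong) (auto simp: N')
  also have "\<dots> = distr (label_measure V N) (PiM V (\<lambda>x. measure_pmf (N (g x)))) (relabel V g)"
    unfolding label_measure_def relabel_def
    by (rule distr_PiM_reindex[symmetric]) (auto simp: g' prob_space_measure_pmf)
  also have "\<dots> = distr (label_measure V N) (label_space V) (relabel V g)"
    by (rule distr_cong) (auto simp: label_space_def intro!: sets_PiM_cong)
  finally have "emeasure (label_measure V N') A = emeasure (distr (label_measure V N) (label_space V) (relabel V g)) A"
    by simp
  also have "\<dots> = emeasure (label_measure V N) (relabel V g -` A \<inter> space (label_measure V N))"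
  proof (rule emeasure_distr[OF _ A])
    show "relabel V g \<in> measurable (label_measure V N) (label_space V)"
      using measurable_relabel[OF g'(2)] unfolding measurable_cong_sets[OF sets_label_measure refl] .
  qed
  finally show ?thesis by (simp add: space_label_measure)
qed

text \<open>Moving the path by \<open>h\<close> moves the trail, which is the same as moving the labelling back.\<close>

lemma emeasure_Q_path_relabel:
  assumes h: "bij_betw h V V" and X: "\<And>n. X n \<in> V" and A: "A \<in> sets (label_space V)"
  shows "emeasure (Q_path V \<mu> \<nu> X) (relabel V (inv_into V h) -` A \<inter> space (label_space V)) =
    emeasure (Q_path V \<mu> \<nu> (\<lambda>i. h (X i))) A"
proof -
  define g where "g = inv_into V h"
  define N where "N x = (if x \<in> range X then \<nu> else \<mu>)" for x
  define N' where "N' x = (if x \<in> range (\<lambda>i. h (X i)) then \<nu> else \<mu>)" for x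
  have g: "bij_betw g V V" unfolding g_def by (rule bij_betw_inv_into[OF h])
  have N': "N' x = N (g x)" if x: "x \<in> V" for x
  proof -
    have "h (g x) = x" unfolding g_def using h x by (rule bij_betw_inv_into_right)
    moreover have "g (h (X i)) = X i" for i unfolding g_def using h X by (rule bij_betw_inv_into_left)
    ultimately have "x \<in> range (\<lambda>i. h (X i)) \<longleftrightarrow> g x \<in> range X"
      unfolding image_iff by metis
    then show ?thesis by (simp only: N_def N'_def)
  qed
  have "emeasure (label_measure V N) (relabel V g -` A \<inter> space (label_space V)) =
      emeasure (label_measure V N') A"
    by (rule emeasure_label_measure_relabel[OF g A]) (rule N')
  then show ?thesis by (simp only: Q_path_eq N_def[abs_def] N'_def[abs_def] g_def)
qed

lemma emeasure_Q_path_shift: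
  assumes A: "A \<in> sets (label_space V)" "finite_change_closed V A" and X: "\<And>n. X n \<in> V"
  shows "emeasure (Q_path V \<mu> \<nu> (\<lambda>i. X (Suc i))) A = emeasure (Q_path V \<mu> \<nu> X) A"
  unfolding Q_path_eq
proof (rule emeasure_label_measure_cong_off[where j="X 0"])
  show "w(X 0 := a) \<in> A" if "w \<in> A" for w a
    using that A(2) X unfolding finite_change_closed_def by blast
  fix x assume "x \<noteq> X 0"
  moreover have "range X = insert (X 0) (range (\<lambda>i. X (Suc i)))"
  proof -
    have "range X = X ` insert 0 (range Suc)" by (simp only: UNIV_nat_eq[symmetric])
    then show ?thesis by (simp add: image_image)
  qed
  ultimately have "x \<in> range X \<longleftrightarrow> x \<in> range (\<lambda>i. X (Suc i))" by blast
  then show "(if x \<in> range (\<lambda>i. X (Suc i)) then \<nu> else \<mu>) = (if x \<in> range X then \<nu> else \<mu>)"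
    by (simp only:)
qed (rule A(1))

text \<open>The laws \<open>Q\<^sub>X\<close> form a measurable kernel on the paths from a fixed vertex \<open>v\<close>. Putting \<open>v\<close> in front
of an arbitrary sequence produces such a path and does not change \<open>Q\<^sub>X(A)\<close>.\<close>

lemma measurable_Q_path_seq_space:
  assumes v: "v \<in> V" and A: "A \<in> sets (label_space V)" "finite_change_closed V A"
  shows "(\<lambda>X. emeasure (Q_path V \<mu> \<nu> X) A) \<in> borel_measurable (seq_space V)"
proof -
  have 1: "(\<lambda>X. emeasure (Q_path V \<mu> \<nu> X) A) \<in> borel_measurable (path_space V UNIV v)"
    by (rule measurable_emeasure_kernel[OF measurable_prob_algebraD[OF measurable_Q_path[OF refl]] A(1)])
  have 2: "case_nat v \<in> measurable (seq_space V) (path_space V UNIV v)"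
    unfolding path_space_def
  proof (rule measurable_restrict_space2)
    show "case_nat v \<in> measurable (seq_space V) (seq_space V)"
    proof (rule measurable_seq_space)
      show "(\<lambda>X. case_nat v X i) \<in> measurable (seq_space V) (count_space V)" for i
        using v by (cases i) (simp_all add: measurable_component_singleton)
    qed
  qed (auto simp: infinite_paths_def)
  have m: "(\<lambda>X. emeasure (Q_path V \<mu> \<nu> (case_nat v X)) A) \<in> borel_measurable (seq_space V)"
    by (rule measurable_compose[OF 2 1])
  have eq: "emeasure (Q_path V \<mu> \<nu> (case_nat v X)) A = emeasure (Q_path V \<mu> \<nu> X) A"
    if "X \<in> space (seq_space V)" for X
  proof -
    have "case_nat v X n \<in> V" for n using that v by (cases n) (auto simp: space_seq_space)
    then show ?thesis using emeasure_Q_path_shift[OF A, of "case_nat v X" \<mu> \<nu>] by simp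
  qed
  have "(\<lambda>X. emeasure (Q_path V \<mu> \<nu> (case_nat v X)) A) \<in> borel_measurable (seq_space V) \<longleftrightarrow>
      (\<lambda>X. emeasure (Q_path V \<mu> \<nu> X) A) \<in> borel_measurable (seq_space V)"
    by (rule measurable_cong) (rule eq)
  then show ?thesis using m by (rule iffD1)
qed

section \<open>The law of the chain and its symmetries\<close>

lemma markov_chain_law_measurable:
  assumes "markov_chain_law V E M v \<Psi>"
  shows "(\<lambda>X. X) \<in> measurable \<Psi> (seq_space V)" and "X \<in> space \<Psi> \<Longrightarrow> X \<in> space (seq_space V)"
    and "X \<in> space \<Psi> \<Longrightarrow> X 0 = v"
proof -
  have \<Psi>: "sets \<Psi> = sets (path_space V E v)" using assms by (simp add: markov_chain_law_def)
  have "(\<lambda>X. X) \<in> measurable (path_space V E v) (seq_space V)"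
    unfolding path_space_def by (intro measurable_restrict_space1 measurable_ident_sets refl)
  then show *: "(\<lambda>X. X) \<in> measurable \<Psi> (seq_space V)"
    unfolding measurable_cong_sets[OF \<Psi> refl] .
  show "X \<in> space \<Psi> \<Longrightarrow> X \<in> space (seq_space V)"
    using measurable_space[OF *] .
  show "X \<in> space \<Psi> \<Longrightarrow> X 0 = v"
    unfolding sets_eq_imp_space_eq[OF \<Psi>] path_space_def
    by (auto simp: space_restrict_space infinite_paths_def)
qed

lemma path_law_markov_chain_law:
  assumes \<Psi>: "markov_chain_law V E M v \<Psi>" and v: "v \<in> V"
  shows "path_law V M v (distr \<Psi> (seq_space V) (\<lambda>X. X))"
proof -
  note meas = markov_chain_law_measurable[OF \<Psi>]
  interpret \<Psi>: prob_space \<Psi> using \<Psi> unfolding markov_chain_law_def by blast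
  let ?R = "distr \<Psi> (seq_space V) (\<lambda>X. X)"
  have "emeasure ?R (cylinder V l) = (if hd l = v then ennreal (path_prob M l) else 0)"
    if l: "l \<in> lists V" "l \<noteq> []" for l
  proof -
    have "(\<lambda>X. X) -` cylinder V l \<inter> space \<Psi> = {X \<in> space \<Psi>. \<forall>i<length l. X i = l ! i}"
      unfolding cylinder_def using meas(2) by blast
    then have eq: "emeasure (distr \<Psi> (seq_space V) (\<lambda>X. X)) (cylinder V l) =
        emeasure \<Psi> {X \<in> space \<Psi>. \<forall>i<length l. X i = l ! i}"
      using emeasure_distr[OF meas(1) sets_cylinder[of V l]] by simp
    have hd: "hd l = l ! 0" using l by (simp add: hd_conv_nth)
    show ?thesis
    proof (cases "hd l = v")
      case True
      define x where "x i = (if i < length l then l ! i else v)" for i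
      define n where "n = length l - 1"
      have n: "length l = Suc n" using l by (simp add: n_def)
      have "x \<in> UNIV \<rightarrow> V" using l v by (auto simp: x_def in_lists_conv_set)
      moreover have "x 0 = v" using True hd by (simp add: x_def)
      ultimately have "measure \<Psi> {X \<in> space \<Psi>. \<forall>i\<le>n. X i = x i} = (\<Prod>i<n. pmf (M (x i)) (x (Suc i)))"
        using \<Psi> unfolding markov_chain_law_def by blast
      also have "\<dots> = path_prob M l"
        unfolding path_prob_eq_prod n_def[symmetric] by (intro prod.cong) (auto simp: x_def n)
      also have "{X \<in> space \<Psi>. \<forall>i\<le>n. X i = x i} = {X \<in> space \<Psi>. \<forall>i<length l. X i = l ! i}"
        by (simp add: x_def n less_Suc_eq_le)
      finally show ?thesis using True eq by (simp add: \<Psi>.emeasure_eq_measure)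
    next
      case False
      have empty: "{X \<in> space \<Psi>. \<forall>i<length l. X i = l ! i} = {}"
      proof (rule ccontr)
        assume "{X \<in> space \<Psi>. \<forall>i<length l. X i = l ! i} \<noteq> {}"
        then obtain X where X: "X \<in> space \<Psi>" "\<forall>i<length l. X i = l ! i" by blast
        then have "X 0 = hd l" using l(2) hd by simp
        then show False using meas(3)[OF X(1)] False by simp
      qed
      show ?thesis unfolding eq empty using False by simp
    qed
  qed
  moreover have "prob_space ?R" by (rule \<Psi>.prob_space_distr[OF meas(1)])
  ultimately show ?thesis unfolding path_law_def by simp
qed

lemma kernel_symmetry_exists:
  assumes H: "subgroup H (graph_aut_group V E)" and trans: "acts_transitively_on H V"
    and inv: "\<And>h x y. h \<in> H \<Longrightarrow> x \<in> V \<Longrightarrow> y \<in> V \<Longrightarrow> pmf (M (h x)) (h y) = pmf (M x) y"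
    and xy: "x \<in> V" "y \<in> V"
  obtains h where "kernel_symmetry V M h" "h x = y"
proof -
  obtain h where h: "h \<in> H" "h x = y"
    using trans xy unfolding acts_transitively_on_def by blast
  have "h \<in> graph_aut V E"
    using subgroup.subset[OF H] h(1) by (auto simp: graph_aut_group_def)
  then have "bij_betw h V V" by (simp add: graph_aut_def Bij_def)
  then have "kernel_symmetry V M h"
    unfolding kernel_symmetry_def using inv[OF h(1)] by blast
  then show ?thesis using h(2) by (rule that)
qed

section \<open>The dichotomy\<close>

text \<open>The supremum of \<open>Q\<close> over the null sets of \<open>P\<close> is approached along a sequence, and the union of the
sequence attains it. The resulting set carries the part of \<open>Q\<close> that is singular to \<open>P\<close>.\<close>

lemma maximal_null_set:
  assumes fin: "finite_measure Q" and sets: "sets Q = sets P"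
  obtains A where "A \<in> null_sets P" "\<And>B. B \<in> null_sets P \<Longrightarrow> emeasure Q B \<le> emeasure Q A"
proof -
  have "null_sets P \<noteq> {}" by auto
  then obtain f :: "nat \<Rightarrow> ennreal" where f: "range f \<subseteq> emeasure Q ` null_sets P"
    "Sup (emeasure Q ` null_sets P) = (SUP n. f n)"
    using ennreal_SUP_countable_SUP[of "null_sets P" "emeasure Q"] by blast
  then have "\<forall>n. \<exists>B\<in>null_sets P. f n = emeasure Q B" by blast
  then obtain B where B: "\<And>n. B n \<in> null_sets P" "\<And>n. f n = emeasure Q (B n)" by metis
  let ?A = "\<Union>n. B n"
  have A: "?A \<in> null_sets P" using B(1) by blast
  have "f n \<le> emeasure Q ?A" for n
    unfolding B(2) using A by (intro emeasure_mono) (auto simp: sets)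
  then have "Sup (emeasure Q ` null_sets P) \<le> emeasure Q ?A"
    unfolding f(2) by (rule SUP_least)
  then have "emeasure Q C \<le> emeasure Q ?A" if "C \<in> null_sets P" for C
    by (rule order_trans[OF SUP_upper[OF that]])
  then show ?thesis using A that by blast
qed

lemma sets_P_Q: "sets (Q_measure V \<mu> \<nu> \<Psi>) = sets (P_measure V \<mu>)"
  by (simp add: sets_P_measure sets_Q_measure)

lemma finite_change_closure_null_Q:
  fixes \<mu> \<nu> :: "'o::finite pmf"
  assumes V: "countable V" and \<Psi>: "sets \<Psi> = sets (path_space V E v)"
    and A: "A \<in> null_sets (Q_measure V \<mu> \<nu> \<Psi>)"
    and pos: "\<And>\<omega>. pmf \<mu> \<omega> > 0" "\<And>\<omega>. pmf \<nu> \<omega> > 0"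
  shows "finite_change_closure V A \<in> null_sets (Q_measure V \<mu> \<nu> \<Psi>)"
proof -
  have As: "A \<in> sets (label_space V)" using A by (auto simp: sets_Q_measure)
  have Cs: "finite_change_closure V A \<in> sets (label_space V)"
    by (rule sets_finite_change_closure[OF V As])
  have meas: "(\<lambda>X. emeasure (Q_path V \<mu> \<nu> X) B) \<in> borel_measurable \<Psi>"
    if "B \<in> sets (label_space V)" for B
    using measurable_prob_algebraD[OF measurable_Q_path[OF \<Psi>]] that
    by (rule measurable_emeasure_kernel)
  have "(\<integral>\<^sup>+ X. emeasure (Q_path V \<mu> \<nu> X) A \<partial>\<Psi>) = 0"
    using A emeasure_Q_measure[OF \<Psi> As, of \<mu> \<nu>] by auto
  then have "AE X in \<Psi>. emeasure (Q_path V \<mu> \<nu> X) A = 0"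
    by (simp add: nn_integral_0_iff_AE[OF meas[OF As]])
  moreover have "emeasure (Q_path V \<mu> \<nu> X) (finite_change_closure V A) = 0"
    if "emeasure (Q_path V \<mu> \<nu> X) A = 0" for X
  proof -
    have "A \<in> null_sets (Q_path V \<mu> \<nu> X)" using that As by (simp add: null_sets_def sets_Q_path)
    from null_finite_change_closure[OF V this[unfolded Q_path_eq]] pos show ?thesis
      unfolding Q_path_eq by (auto simp: null_sets_def)
  qed
  ultimately have "AE X in \<Psi>. emeasure (Q_path V \<mu> \<nu> X) (finite_change_closure V A) = 0" by auto
  then have "emeasure (Q_measure V \<mu> \<nu> \<Psi>) (finite_change_closure V A) = 0"
    unfolding emeasure_Q_measure[OF \<Psi> Cs] by (simp add: nn_integral_0_iff_AE[OF meas[OF Cs]])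
  then show ?thesis using Cs by (simp add: null_sets_def sets_Q_measure)
qed

text \<open>If some \<open>Q\<close>-null set has positive \<open>P\<close>-measure, then so does its closure under finite changes, which is
still \<open>Q\<close>-null and has full \<open>P\<close>-measure by Kolmogorov's law.\<close>

lemma P_absolutely_continuous_or_singular:
  fixes \<mu> \<nu> :: "'o::finite pmf"
  assumes V: "countable V" and \<Psi>: "sets \<Psi> = sets (path_space V E v)"
    and pos: "\<And>\<omega>. pmf \<mu> \<omega> > 0" "\<And>\<omega>. pmf \<nu> \<omega> > 0"
  shows "absolutely_continuous (Q_measure V \<mu> \<nu> \<Psi>) (P_measure V \<mu>) \<or>
    mutually_singular (P_measure V \<mu>) (Q_measure V \<mu> \<nu> \<Psi>)"
proof (cases "null_sets (Q_measure V \<mu> \<nu> \<Psi>) \<subseteq> null_sets (P_measure V \<mu>)")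
  case False
  let ?P = "P_measure V \<mu>" and ?Q = "Q_measure V \<mu> \<nu> \<Psi>"
  interpret P: prob_space ?P unfolding P_measure_eq by (rule prob_space_label_measure)
  obtain B where B: "B \<in> null_sets ?Q" "B \<notin> null_sets ?P" using False by blast
  let ?C = "finite_change_closure V B"
  have Bs: "B \<in> sets (label_space V)" using B(1) by (auto simp: sets_Q_measure)
  have C: "?C \<in> null_sets ?Q"
    by (rule finite_change_closure_null_Q[OF V \<Psi> B(1) pos])
  then have Cs: "?C \<in> sets (label_space V)" by (auto simp: sets_Q_measure)
  have "emeasure ?P B \<le> emeasure ?P ?C"
    using finite_change_closure_superset[OF sets.sets_into_space[OF Bs]] Cs
    by (intro emeasure_mono) (auto simp: sets_P_measure)
  moreover have "emeasure ?P B \<noteq> 0" using B(2) Bs by (auto simp: null_sets_def sets_P_measure)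
  ultimately have "emeasure ?P ?C \<noteq> 0" by auto
  then have P1: "emeasure ?P ?C = 1"
    using finite_change_closed_zero_one[OF Cs finite_change_closed_closure, of "\<lambda>_. \<mu>"]
    by (simp add: P_measure_eq)
  have Csp: "?C \<subseteq> space ?Q" using C sets.sets_into_space[of ?C ?Q] by auto
  have sp: "space ?P = space ?Q" by (rule sets_eq_imp_space_eq[OF sets_P_Q, symmetric])
  let ?A = "space ?Q - ?C"
  have "emeasure ?P ?A = 0"
    using emeasure_compl[of ?C ?P] Cs P1 P.emeasure_space_1 sp by (simp add: sets_P_measure)
  moreover have "space ?Q - ?A = ?C" using Csp by blast
  then have "emeasure ?Q (space ?Q - ?A) = 0" using C by auto
  moreover have "?A \<in> sets ?Q" using C by (intro sets.compl_sets) auto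
  then have "?A \<in> sets ?P \<inter> sets ?Q" by (simp add: sets_P_Q)
  ultimately have "mutually_singular ?P ?Q" unfolding mutually_singular_def by blast
  then show ?thesis ..
qed (auto simp: absolutely_continuous_def)

text \<open>Let \<open>A0\<close> be a \<open>P\<close>-null set of maximal \<open>Q\<close>-measure. The set \<open>A\<close> used in the argument has to be as good as
\<open>A0\<close> for the chains from all starting vertices at once. It therefore contains the translates of \<open>A0\<close> by
countably many symmetries \<open>h x\<close>, one for each vertex, and is then closed under finite changes. The
symmetries and the finite changes preserve \<open>P\<close>-null sets, so \<open>A\<close> is still \<open>P\<close>-null. The lemma on
shift-invariant events shows that \<open>Q(A)\<close>, which equals the maximum, is 0 or 1.\<close>

lemma Q_absolutely_continuous_or_singular:
  fixes V :: "'v set" and \<mu> \<nu> :: "'o::finite pmf"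
  assumes V: "countable V" and v: "v \<in> V" and \<Psi>: "markov_chain_law V E M v \<Psi>"
    and sym: "\<And>x. x \<in> V \<Longrightarrow> \<exists>h. kernel_symmetry V M h \<and> h v = x"
    and pos: "\<And>\<omega>. pmf \<mu> \<omega> > 0"
  shows "absolutely_continuous (P_measure V \<mu>) (Q_measure V \<mu> \<nu> \<Psi>) \<or>
    mutually_singular (P_measure V \<mu>) (Q_measure V \<mu> \<nu> \<Psi>)"
proof -
  let ?P = "P_measure V \<mu>" and ?Q = "Q_measure V \<mu> \<nu> \<Psi>"
  let ?sp = "space (label_space V)"
  have \<Psi>s: "sets \<Psi> = sets (path_space V E v)" using \<Psi> by (simp add: markov_chain_law_def)
  interpret \<Psi>: prob_space \<Psi> using \<Psi> by (simp add: markov_chain_law_def)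
  note meas = markov_chain_law_measurable[OF \<Psi>]
  note Q_eq = emeasure_Q_measure[OF \<Psi>s, of _ \<mu> \<nu>]
  define R where "R = distr \<Psi> (seq_space V) (\<lambda>X. X)"
  have R: "path_law V M v R" unfolding R_def by (rule path_law_markov_chain_law[OF \<Psi> v])
  have spQ: "space ?Q = ?sp" by (rule sets_eq_imp_space_eq[OF sets_Q_measure])
  have Q1: "emeasure ?Q (space ?Q) = 1"
  proof -
    have "emeasure (Q_path V \<mu> \<nu> X) ?sp = 1" for X
      using prob_space.emeasure_space_1[OF prob_space_Q_path, of V \<mu> \<nu> X]
        sets_eq_imp_space_eq[OF sets_Q_path, of V \<mu> \<nu> X] by metis
    then show ?thesis by (simp add: spQ Q_eq \<Psi>.emeasure_space_1)
  qed
  then have finQ: "finite_measure ?Q" by (intro finite_measureI) simp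
  obtain h where h: "\<And>x. x \<in> V \<Longrightarrow> kernel_symmetry V M (h x)" "\<And>x. x \<in> V \<Longrightarrow> h x v = x"
    using sym by metis
  have bij: "bij_betw (h x) V V" if "x \<in> V" for x using h(1)[OF that] by (simp add: kernel_symmetry_def)
  have hV: "h x y \<in> V" if "x \<in> V" "y \<in> V" for x y
    using bij_betwE[OF bij[OF that(1)]] that(2) by blast
  define T where "T g A = relabel V g -` A \<inter> ?sp" for g :: "'v \<Rightarrow> 'v" and A :: "('v \<Rightarrow> 'o) set"
  have T_sets: "T g A \<in> sets (label_space V)"
    if "bij_betw g V V" "A \<in> sets (label_space V)" for g A
    unfolding T_def using that by (intro measurable_sets[OF measurable_relabel]) (auto simp: bij_betw_def)
  have T_null: "T g A \<in> null_sets ?P" if "bij_betw g V V" "A \<in> null_sets ?P" for g A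
  proof -
    have As: "A \<in> sets (label_space V)" using that(2) by (auto simp: sets_P_measure)
    have "emeasure ?P (T g A) = emeasure ?P A"
      unfolding T_def P_measure_eq by (rule emeasure_label_measure_relabel[OF that(1) As refl])
    then show ?thesis using that(2) T_sets[OF that(1) As] by (auto simp: null_sets_def sets_P_measure)
  qed
  obtain A0 where A0: "A0 \<in> null_sets ?P" "\<And>B. B \<in> null_sets ?P \<Longrightarrow> emeasure ?Q B \<le> emeasure ?Q A0"
    using maximal_null_set[OF finQ sets_P_Q] by blast
  have A0_max: "emeasure ?Q B = emeasure ?Q A0" if "B \<in> null_sets ?P" "A0 \<subseteq> B" for B
    using A0(2)[OF that(1)] emeasure_mono[OF that(2), of ?Q] that(1) by (auto simp: sets_P_Q intro: antisym)
  have A0sp: "A0 \<subseteq> ?sp"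
    by (rule sets.sets_into_space) (rule null_setsD2[OF A0(1), unfolded sets_P_measure])
  define A1 where "A1 = A0 \<union> (\<Union>x\<in>V. T (h x) A0)"
  define A where "A = finite_change_closure V A1"
  have A1_null: "A1 \<in> null_sets ?P"
    unfolding A1_def by (intro null_sets.Un null_sets_UN' V T_null bij A0(1))
  have A_null: "A \<in> null_sets ?P"
    unfolding A_def using null_finite_change_closure[OF V A1_null[unfolded P_measure_eq]] pos
    by (auto simp: P_measure_eq)
  have As: "A \<in> sets (label_space V)" using A_null by (auto simp: sets_P_measure)
  have A1A: "A1 \<subseteq> A"
    unfolding A_def by (rule finite_change_closure_superset) (use A0sp in \<open>auto simp: A1_def T_def\<close>)
  have closed: "finite_change_closed V A" unfolding A_def by (rule finite_change_closed_closure)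
  have QA: "emeasure ?Q A = emeasure ?Q A0" using A0_max[OF A_null] A1A by (auto simp: A1_def)
  \<comment> \<open>This is the measure of \<open>A\<close> under the labels produced by the chain from \<open>x\<close>. It is at most
    the maximum because moving \<open>A\<close> back yields another \<open>P\<close>-null set, and at least the maximum because
    that set contains \<open>A0\<close>.\<close>
  have QT: "emeasure ?Q (T (inv_into V (h x)) A) = emeasure ?Q A0" if x: "x \<in> V" for x
  proof (rule A0_max)
    let ?g = "inv_into V (h x)"
    have g: "bij_betw ?g V V" by (rule bij_betw_inv_into[OF bij[OF x]])
    show "T ?g A \<in> null_sets ?P" by (rule T_null[OF g A_null])
    show "A0 \<subseteq> T ?g A"
    proof
      fix w assume w: "w \<in> A0"
      then have wsp: "w \<in> ?sp" using A0sp by blast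
      have "relabel V (h x) (relabel V ?g w) = w"
      proof
        show "relabel V (h x) (relabel V ?g w) y = w y" for y
          using wsp hV[OF x] bij_betw_inv_into_left[OF bij[OF x]]
          by (auto simp: relabel_def space_label_space PiE_def extensional_def)
      qed
      moreover have "relabel V ?g w \<in> ?sp" by (auto simp: relabel_def space_label_space)
      ultimately have "relabel V ?g w \<in> T (h x) A0" using w by (simp add: T_def)
      then have "relabel V ?g w \<in> A" using x A1A by (auto simp: A1_def)
      then show "w \<in> T ?g A" using wsp by (simp add: T_def)
    qed
  qed
  define D where "D = {X \<in> space (seq_space V). emeasure (Q_path V \<mu> \<nu> X) A = 1}"
  have Dm: "D \<in> sets (seq_space V)"
    unfolding D_def using measurable_Q_path_seq_space[OF v As closed] by measurable
  \<comment> \<open>Kolmogorov's law turns \<open>Q\<^sub>X(A)\<close> into the indicator of an event for the path.\<close>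
  have ind: "emeasure (Q_path V \<mu> \<nu> X) A = indicator D X" if "X \<in> space (seq_space V)" for X
    using that finite_change_closed_zero_one[OF As closed, of "\<lambda>x. if x \<in> range X then \<nu> else \<mu>"]
    by (auto simp: D_def Q_path_eq split: split_indicator)
  have int: "emeasure R D' = (\<integral>\<^sup>+ X. indicator D' X \<partial>\<Psi>)" if "D' \<in> sets (seq_space V)" for D'
  proof -
    have "emeasure R D' = (\<integral>\<^sup>+ X. indicator D' X \<partial>R)" using that by (simp add: R_def)
    also have "\<dots> = (\<integral>\<^sup>+ X. indicator D' X \<partial>\<Psi>)"
      unfolding R_def by (rule nn_integral_distr[OF meas(1)]) (use that in simp)
    finally show ?thesis .
  qed
  have RD: "emeasure R D = emeasure ?Q A"
    unfolding int[OF Dm] Q_eq[OF As] by (intro nn_integral_cong ind[symmetric] meas(2))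
  have "emeasure R D = 0 \<or> emeasure R D = 1"
  proof (rule symmetric_shift_invariant_zero_one[OF V R v Dm])
    fix X assume X: "X \<in> space (seq_space V)"
    then show "(\<lambda>i. X (Suc i)) \<in> D \<longleftrightarrow> X \<in> D"
      using emeasure_Q_path_shift[OF As closed, of X] by (simp add: D_def space_seq_space)
  next
    fix x assume x: "x \<in> V"
    let ?hD = "{X \<in> space (seq_space V). (\<lambda>i. h x (X i)) \<in> D}"
    have "?hD \<in> sets (seq_space V)"
      using measurable_sets[OF measurable_map_path[of "h x" V] Dm] hV[OF x]
      by (auto simp: vimage_def Int_def conj_commute)
    then have "emeasure R ?hD = (\<integral>\<^sup>+ X. indicator ?hD X \<partial>\<Psi>)" by (rule int)
    also have "\<dots> = (\<integral>\<^sup>+ X. emeasure (Q_path V \<mu> \<nu> X) (T (inv_into V (h x)) A) \<partial>\<Psi>)"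
    proof (rule nn_integral_cong)
      fix X assume "X \<in> space \<Psi>"
      then have X: "X \<in> space (seq_space V)" by (rule meas(2))
      then have hX: "(\<lambda>i. h x (X i)) \<in> space (seq_space V)" using hV[OF x] by (simp add: space_seq_space)
      have "emeasure (Q_path V \<mu> \<nu> X) (T (inv_into V (h x)) A) =
          emeasure (Q_path V \<mu> \<nu> (\<lambda>i. h x (X i))) A"
        unfolding T_def by (rule emeasure_Q_path_relabel[OF bij[OF x] _ As]) (use X in \<open>simp add: space_seq_space\<close>)
      also have "\<dots> = indicator ?hD X" using ind[OF hX] X by (simp add: indicator_def)
      finally show "indicator ?hD X = emeasure (Q_path V \<mu> \<nu> X) (T (inv_into V (h x)) A)" by simp
    qed
    also have "\<dots> = emeasure ?Q (T (inv_into V (h x)) A)"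
      by (rule Q_eq[symmetric]) (rule T_sets[OF bij_betw_inv_into[OF bij[OF x]] As])
    also have "\<dots> = emeasure R D" using QT[OF x] QA RD by simp
    finally show "\<exists>h. kernel_symmetry V M h \<and> h v = x \<and>
        emeasure R {X \<in> space (seq_space V). (\<lambda>i. h (X i)) \<in> D} = emeasure R D"
      using h[OF x] by blast
  qed
  then show ?thesis
  proof
    assume "emeasure R D = 0"
    then have "emeasure ?Q A0 = 0" using RD QA by simp
    then have "null_sets ?P \<subseteq> null_sets ?Q"
      using A0(2) by (auto simp: null_sets_def sets_P_Q)
    then show ?thesis by (simp add: absolutely_continuous_def)
  next
    assume "emeasure R D = 1"
    then have "emeasure ?Q A = 1" using RD by simp
    then have "emeasure ?Q (space ?Q - A) = 0"
      using finite_measure.emeasure_finite[OF finQ, of A] emeasure_compl[of A ?Q] Q1 As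
      by (simp add: sets_Q_measure)
    then have "mutually_singular ?P ?Q"
      unfolding mutually_singular_def using A_null by (auto simp: sets_P_Q intro!: bexI[of _ A])
    then show ?thesis ..
  qed
qed

theorem proposition1p1:
  fixes V :: "'v set" and E :: "('v \<times> 'v) set" and v :: 'v
    and H :: "('v \<Rightarrow> 'v) set" and M :: "'v \<Rightarrow> 'v pmf"
    and \<Psi> :: "(nat \<Rightarrow> 'v) measure"
    and \<mu> \<nu> :: "'o::finite pmf"
  assumes "countable V" and "infinite V"
    and "transitive_graph V E" and "v \<in> V"
    and "transition_kernel_on V M"
    and "subgroup H (graph_aut_group V E)"
    and "acts_transitively_on H V"
    and "\<And>h x y. h \<in> H \<Longrightarrow> x \<in> V \<Longrightarrow> y \<in> V \<Longrightarrow> pmf (M (h x)) (h y) = pmf (M x) y"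
    and "markov_chain_law V E M v \<Psi>"
    and "transient_law V \<Psi>"
    and "\<mu> \<noteq> \<nu>"
    and "\<And>\<omega>. pmf \<mu> \<omega> > 0" and "\<And>\<omega>. pmf \<nu> \<omega> > 0"
  shows "mutually_singular (P_measure V \<mu>) (Q_measure V \<mu> \<nu> \<Psi>) \<or>
         mutually_absolutely_continuous (P_measure V \<mu>) (Q_measure V \<mu> \<nu> \<Psi>)"
proof -
  have \<Psi>: "sets \<Psi> = sets (path_space V E v)" using assms(9) by (simp add: markov_chain_law_def)
  have "\<exists>h. kernel_symmetry V M h \<and> h v = x" if "x \<in> V" for x
    using kernel_symmetry_exists[OF assms(6-8,4) that] by metis
  from Q_absolutely_continuous_or_singular[OF assms(1,4,9) this assms(12), of \<nu>]
    P_absolutely_continuous_or_singular[OF assms(1) \<Psi> assms(12,13)]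
  show ?thesis unfolding mutually_absolutely_continuous_def by blast
qed

end
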